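(* Let $M,K$ be real skew-symmetric $d\times d$ matrices and let $S(z,x)$ be a real-valued function, smooth in $z\in\mathbb{R}^d$, with gradient $\nabla_z S$ in $z$. Let $\Delta t,\Delta x>0$ and $x_n\in\mathbb{R}$. Let $(\tilde a_{jk},\tilde b_j,\tilde c_j)_{1\le j,k\le r}$ be the coefficients of the $r$-stage Gauss--Legendre collocation Runge--Kutta method, and let $A_{\tau,\sigma}$, $b_i$, $\langle\cdot\rangle_i$ ($i=1,\ldots,s$) be the objects attached to the continuous Runge--Kutta method with nodes $c_1,\ldots,c_s$ (defined in the context). Suppose that the $\mathbb{R}^d$-valued polynomials in $\tau$ denoted $z_n^\tau$, $z_{n+1}^\tau$, $z_{n,j}^\tau$, $\delta_t z_{n,j}^\tau$, $\delta_x z_{n,j}^\tau$ ($j=1,\ldots,r$) satisfy the scheme $$ \begin{aligned} &z_{n,j}^{\tau}=z_{n,j}^{0}+\Delta t\int_{0}^{1}A_{\tau,\sigma}\,\delta_{t}z_{n,j}^{\sigma}\,d\sigma,\qquad z_{n,j}^{1}=z_{n,j}^{0}+\Delta t\int_{0}^{1}\delta_{t}z_{n,j}^{\sigma}\,d\sigma,\\ &z_{n,j}^{\tau}=z_{n}^{\tau}+\Delta x\sum_{k=1}^{r}\tilde{a}_{jk}\,\delta_{x}z_{n,k}^{\tau},\qquad z_{n+1}^{\tau}=z_{n}^{\tau}+\Delta x\sum_{j=1}^{r}\tilde{b}_{j}\,\delta_{x}z_{n,j}^{\tau},\\ &M\delta_{t}z_{n,j}^{\tau}+K\delta_{x}z_{n,j}^{\tau}=\nabla_{z}S(z_{n,j}^{\tau},x_{n}+\tilde{c}_{j}\Delta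 x), \end{aligned} $$ for all $\tau\in[0,1]$ and $j=1,\ldots,r$, and let $\delta_t z_n^\tau$, $\delta_t z_{n+1}^\tau$, $\delta_x\delta_t z_{n,j}^\tau$, $\delta_t\delta_x z_{n,j}^\tau$ be auxiliary quantities satisfying the auxiliary system given in the context. Then the following discrete local energy conservation law holds: $$ \Delta x\sum_{j=1}^{r}\tilde{b}_{j}\,(E_{n,j}^{1}-E_{n,j}^{0})+\Delta t\,(\bar{F}_{n+1}-\bar{F}_{n})=0, $$ where $$ E_{n,j}^{\alpha}=S(z_{n,j}^{\alpha},x_{n}+\tilde{c}_{j}\Delta x)-\tfrac12 (z_{n,j}^{\alpha})^{\top}K\,\delta_{x}z_{n,j}^{\alpha}\quad(\alpha=0,1), $$ $$ \bar{F}_{\beta}=\frac12\sum_{i=1}^{s}b_{i}\,\langle z_{\beta}\rangle_{i}^{\top}K\langle\delta_{t}z_{\beta}\rangle_{i}\quad(\beta=n,\,n+1). $$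
   Context: The scheme is a discretization of the PDE $Mz_t+Kz_x=\nabla_z S(z,x)$ on the box $[x_n,x_n+\Delta x]\times[t_0,t_0+\Delta t]$, with $z_n^\tau\approx z(x_n,t_0+\tau\Delta t)$, $z_{n+1}^\tau\approx z(x_n+\Delta x,t_0+\tau\Delta t)$, $z_{n,j}^\tau\approx z(x_n+\tilde c_j\Delta x,t_0+\tau\Delta t)$, and $\delta_t z_{n,j}^\tau$, $\delta_x z_{n,j}^\tau$ approximating the corresponding partial derivatives. All symbols prefixed by $\delta_t,\delta_x,\delta_t\delta_x,\delta_x\delta_t$ denote unknown functions of $\tau$ related to the others only through the stated equations. Continuous Runge--Kutta (CRK) method: $c_1,\ldots,c_s$ are distinct real nodes, $l_1,\ldots,l_s$ are the Lagrange interpolating polynomials based on these nodes, $b_i=\int_0^1 l_i(\tau)\,d\tau$ (assumed nonzero), and $$A_{\tau,\sigma}=\sum_{i=1}^{s}\frac{1}{b_i}\left(\int_0^\tau l_i(\alpha)\,d\alpha\right) l_i(\sigma).$$ For a function $f$ of $\tau\in[0,1]$, $\langle f\rangle_i=\frac{1}{b_i}\int_0^1 l_i(\tau)f(\tau)\,d\tau$; e.g. $\langle z_n\rangle_i=\frac1{b_i}\int_0^1 l_i(\tau)z_n^\tau\,d\tau$. Gauss--Legendre method: $\tilde c_1,\ldots,\tilde c_r$ are the zeros of the $r$-th Legendre polynomial shifted to $[0,1]$, $\tilde l_k$ the corresponding Lagrange polynomials, $\tilde a_{jk}=\int_0^{\tilde c_j}\tilde l_k(\xi)\,d\xi$, $\tilde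 b_k=\int_0^1\tilde l_k(\xi)\,d\xi$. Auxiliary system: for all $\tau\in[0,1]$ and $j=1,\ldots,r$, $$ \begin{aligned} &\delta_{x}z_{n,j}^{\tau}=\delta_{x}z_{n,j}^{0}+\Delta t\int_{0}^{1}A_{\tau,\sigma}\,\delta_{t}\delta_{x}z_{n,j}^{\sigma}\,d\sigma,\qquad \delta_{x}z_{n,j}^{1}=\delta_{x}z_{n,j}^{0}+\Delta t\int_{0}^{1}\delta_{t}\delta_{x}z_{n,j}^{\sigma}\,d\sigma,\\ &\delta_{t}z_{n,j}^{\tau}=\delta_{t}z_{n}^{\tau}+\Delta x\sum_{k=1}^{r}\tilde{a}_{jk}\,\delta_{x}\delta_{t}z_{n,k}^{\tau},\qquad \delta_{t}z_{n+1}^{\tau}=\delta_{t}z_{n}^{\tau}+\Delta x\sum_{j=1}^{r}\tilde{b}_{j}\,\delta_{x}\delta_{t}z_{n,j}^{\tau}, \end{aligned} $$ where $\delta_t z_n^\tau$ is the CRK time derivative at the grid point $x_n$, i.e. $z_n^\tau=z_n^0+\Delta t\int_0^1A_{\tau,\sigma}\,\delta_t z_n^\sigma\,d\sigma$ for all $\tau\in[0,1]$. *)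

theory Defs
  imports "HOL-Analysis.Analysis" "HOL-Computational_Algebra.Polynomial"
begin

text \<open>
  Families indexed by \<open>1, \<dots>, n\<close> are functions on \<^typ>\<open>nat\<close>, of which only the values on
  \<open>{1..n}\<close> matter. Antiderivatives \<open>\<integral>\<^sub>0\<^sup>x\<close> are written with the oriented integral
  \<open>LBINT y=0..x\<close>; integrals over the fixed interval \<open>[0,1]\<close> are Henstock--Kurzweil integrals.
\<close>

definition lagrange_basis :: "(nat \<Rightarrow> real) \<Rightarrow> nat \<Rightarrow> nat \<Rightarrow> real \<Rightarrow> real" where
  "lagrange_basis c n i x = (\<Prod>k\<in>{1..n} - {i}. (x - c k) / (c i - c k))"

definition quad_weight :: "(nat \<Rightarrow> real) \<Rightarrow> nat \<Rightarrow> nat \<Rightarrow> real" where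
  "quad_weight c n i = integral {0..1} (lagrange_basis c n i)"

definition colloc_coeff :: "(nat \<Rightarrow> real) \<Rightarrow> nat \<Rightarrow> nat \<Rightarrow> nat \<Rightarrow> real" where
  "colloc_coeff c n j k = (LBINT \<xi>=0..c j. lagrange_basis c n k \<xi>)"

definition crk_A :: "(nat \<Rightarrow> real) \<Rightarrow> nat \<Rightarrow> real \<Rightarrow> real \<Rightarrow> real" where
  "crk_A c s \<tau> \<sigma> =
     (\<Sum>i=1..s. 1 / quad_weight c s i * (LBINT \<alpha>=0..\<tau>. lagrange_basis c s i \<alpha>)
        * lagrange_basis c s i \<sigma>)"

definition crk_avg ::
    "(nat \<Rightarrow> real) \<Rightarrow> nat \<Rightarrow> nat \<Rightarrow> (real \<Rightarrow> 'a::euclidean_space) \<Rightarrow> 'a" where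
  "crk_avg c s i f =
     (1 / quad_weight c s i) *\<^sub>R integral {0..1} (\<lambda>\<tau>. lagrange_basis c s i \<tau> *\<^sub>R f \<tau>)"

text \<open>The Legendre polynomial \<open>P\<^sub>n\<close>, by Rodrigues' formula
  \<open>P\<^sub>n(x) = 1 / (2\<^sup>n n!) (d/dx)\<^sup>n (x\<^sup>2 - 1)\<^sup>n\<close>, and its shift \<open>x \<mapsto> P\<^sub>n(2 x - 1)\<close> to \<open>[0,1]\<close>.\<close>

definition legendre_poly :: "nat \<Rightarrow> real poly" where
  "legendre_poly n = smult (1 / (2 ^ n * fact n)) ((pderiv ^^ n) ([:-1, 0, 1:] ^ n))"

definition shifted_legendre_poly :: "nat \<Rightarrow> real poly" where
  "shifted_legendre_poly n = pcompose (legendre_poly n) [:-1, 2:]"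

text \<open>The nodes enumerate the \<open>r\<close> zeros bijectively; no ordering is imposed.\<close>

definition gauss_legendre_nodes :: "nat \<Rightarrow> (nat \<Rightarrow> real) \<Rightarrow> bool" where
  "gauss_legendre_nodes r c \<longleftrightarrow>
     bij_betw c {1..r} {x. poly (shifted_legendre_poly r) x = 0}"

text \<open>\<open>k\<close> times continuously differentiable on the whole space: differentiable, with all first
  partial derivatives \<open>k - 1\<close> times continuously differentiable.\<close>

primrec Ck_fun :: "nat \<Rightarrow> ('a::euclidean_space \<Rightarrow> real) \<Rightarrow> bool" where
  "Ck_fun 0 f \<longleftrightarrow> continuous_on UNIV f"
| "Ck_fun (Suc k) f \<longleftrightarrow> (\<forall>x. f differentiable (at x)) \<and>
     (\<forall>e\<in>Basis. Ck_fun k (\<lambda>x. frechet_derivative f (at x) e))"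

definition smooth_fun :: "('a::euclidean_space \<Rightarrow> real) \<Rightarrow> bool" where
  "smooth_fun f \<longleftrightarrow> (\<forall>k. Ck_fun k f)"

definition gradient :: "('a::euclidean_space \<Rightarrow> real) \<Rightarrow> 'a \<Rightarrow> 'a" where
  "gradient f x = (THE D. GDERIV f x :> D)"

text \<open>The arguments \<open>w\<close> and \<open>v\<close> stand for \<open>z\<close> and \<open>\<delta>\<^sub>x z\<close> at one point; \<open>z\<close> and \<open>dtz\<close> are the
  functions of \<open>\<tau>\<close> at one grid point.\<close>

definition discrete_energy ::
    "(real^'d \<Rightarrow> real \<Rightarrow> real) \<Rightarrow> real^'d^'d \<Rightarrow> real \<Rightarrow> real^'d \<Rightarrow> real^'d \<Rightarrow> real" where
  "discrete_energy S K x w v = S w x - 1 / 2 * (w \<bullet> (K *v v))"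

definition discrete_flux ::
    "(nat \<Rightarrow> real) \<Rightarrow> nat \<Rightarrow> real^'d^'d \<Rightarrow> (real \<Rightarrow> real^'d) \<Rightarrow> (real \<Rightarrow> real^'d) \<Rightarrow> real" where
  "discrete_flux c s K z dtz =
     1 / 2 * (\<Sum>i=1..s. quad_weight c s i * (crk_avg c s i z \<bullet> (K *v crk_avg c s i dtz)))"

end

theory Submission
  imports Defs
begin

text \<open>
  On \<open>[0,1]\<close> a CRK equation means \<open>z' = \<Delta>t \<Sum>\<^sub>i l\<^sub>i \<langle>\<delta>\<^sub>t z\<rangle>\<^sub>i\<close>. Hence integrating
  \<open>d/d\<tau> S(z\<^sub>j) = \<nabla>S(z\<^sub>j) \<bullet> z\<^sub>j'\<close> and \<open>d/d\<tau> (z\<^sub>j \<bullet> K \<delta>\<^sub>x z\<^sub>j)\<close> over \<open>[0,1]\<close>, where the \<open>M\<close>-term vanishes by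
  skew-symmetry, expresses the energy increment by \<open>\<langle>\<delta>\<^sub>t z\<^sub>j\<rangle>\<^sub>i \<bullet> K \<langle>\<delta>\<^sub>x z\<^sub>j\<rangle>\<^sub>i - \<langle>z\<^sub>j\<rangle>\<^sub>i \<bullet> K \<langle>\<delta>\<^sub>t \<delta>\<^sub>x z\<^sub>j\<rangle>\<^sub>i\<close>.
  The Gauss--Legendre method satisfies \<open>b\<^sub>j a\<^sub>j\<^sub>k + b\<^sub>k a\<^sub>k\<^sub>j = b\<^sub>j b\<^sub>k\<close>, so the bilinear flux increment is
  given by \<open>\<langle>\<delta>\<^sub>x z\<^sub>j\<rangle>\<^sub>i \<bullet> K \<langle>\<delta>\<^sub>t z\<^sub>j\<rangle>\<^sub>i + \<langle>z\<^sub>j\<rangle>\<^sub>i \<bullet> K \<langle>\<delta>\<^sub>x \<delta>\<^sub>t z\<^sub>j\<rangle>\<^sub>i\<close>. Both cancel once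
  \<open>\<langle>\<delta>\<^sub>t \<delta>\<^sub>x z\<^sub>j\<rangle>\<^sub>i = \<langle>\<delta>\<^sub>x \<delta>\<^sub>t z\<^sub>j\<rangle>\<^sub>i\<close>, which holds because the matrix \<open>a\<close> is invertible: \<open>0\<close> is not a zero
  of the shifted Legendre polynomial.
\<close>

subsection \<open>Integrals of polynomials\<close>

lemma integral_poly_pderiv:
  "a \<le> b \<Longrightarrow> (poly (pderiv p) has_integral (poly p b - poly p a)) {a..b}" for a b :: real
  by (rule fundamental_theorem_of_calculus)
     (auto intro!: has_field_derivative_at_within poly_DERIV
           simp flip: has_real_derivative_iff_has_vector_derivative)

lemma poly_integrable: "poly p integrable_on {a..b}" for p :: "real poly"
  by (intro integrable_continuous_real continuous_intros)

lemma pderiv_sum: "pderiv (sum f A) = (\<Sum>x\<in>A. pderiv (f x))"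
  using higher_pderiv_sum[of 1 f A] by simp

text \<open>Kept as a polynomial rather than an integral, so that degree bounds, divisibility and
  \<open>pderiv\<close> apply to the integrated Lagrange polynomials and their products.\<close>

definition antideriv_poly :: "real poly \<Rightarrow> real poly" where
  "antideriv_poly p = (\<Sum>i\<le>degree p. monom (coeff p i / real (Suc i)) (Suc i))"

lemma pderiv_antideriv_poly [simp]: "pderiv (antideriv_poly p) = p"
proof -
  have "pderiv (antideriv_poly p) = (\<Sum>i\<le>degree p. pderiv (monom (coeff p i / real (Suc i)) (Suc i)))"
    unfolding antideriv_poly_def by (rule pderiv_sum)
  also have "\<dots> = (\<Sum>i\<le>degree p. monom (coeff p i) i)"
    by (intro sum.cong refl) (simp add: pderiv_monom del: of_nat_Suc)
  finally show ?thesis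
    by (simp add: poly_as_sum_of_monoms)
qed

lemma poly_antideriv_poly_0 [simp]: "poly (antideriv_poly p) 0 = 0"
  by (simp add: antideriv_poly_def poly_sum poly_monom)

lemma degree_antideriv_poly: "degree (antideriv_poly p) \<le> Suc (degree p)"
  unfolding antideriv_poly_def
  by (intro degree_sum_le) (auto intro: order.trans[OF degree_monom_le])

lemma integral_poly_antideriv_poly: "integral {0..1} (poly p) = poly (antideriv_poly p) 1"
  using integral_unique[OF integral_poly_pderiv[of 0 1 "antideriv_poly p"]] by simp

lemma interval_integral_poly: "(LBINT y=0..x. poly p y) = poly (antideriv_poly p) x"
proof -
  have "(LBINT y=ereal 0..ereal x. poly p y) = poly (antideriv_poly p) x - poly (antideriv_poly p) 0"
    by (rule interval_integral_FTC_finite)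
       (auto intro!: continuous_intros has_field_derivative_at_within
          poly_DERIV[of "antideriv_poly p", simplified]
         simp flip: has_real_derivative_iff_has_vector_derivative)
  then show ?thesis
    by (simp add: zero_ereal_def)
qed

lemma integral_poly_by_parts:
  "integral {0..1} (poly (pderiv p * q)) =
     poly (p * q) 1 - poly (p * q) 0 - integral {0..1} (poly (p * pderiv q))" for p q :: "real poly"
proof -
  have "integral {0..1} (poly (pderiv (p * q))) =
          integral {0..1} (\<lambda>x. poly (pderiv p * q) x + poly (p * pderiv q) x)"
    by (intro arg_cong[where f = "integral {0..1}"]) (simp add: fun_eq_iff pderiv_mult algebra_simps)
  also have "\<dots> = integral {0..1} (poly (pderiv p * q)) + integral {0..1} (poly (p * pderiv q))"
    by (intro Henstock_Kurzweil_Integration.integral_add poly_integrable)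
  finally show ?thesis
    using integral_unique[OF integral_poly_pderiv[of 0 1 "p * q"]] by simp
qed

subsection \<open>Lagrange interpolation\<close>

definition lagrange_poly :: "(nat \<Rightarrow> real) \<Rightarrow> nat \<Rightarrow> nat \<Rightarrow> real poly" where
  "lagrange_poly c n i = (\<Prod>k\<in>{1..n} - {i}. smult (1 / (c i - c k)) [:- c k, 1:])"

lemma lagrange_basis_eq_poly: "lagrange_basis c n i = poly (lagrange_poly c n i)"
  by (simp add: fun_eq_iff lagrange_basis_def lagrange_poly_def poly_prod diff_divide_distrib)

lemma degree_lagrange_poly:
  assumes "i \<in> {1..n}"
  shows "degree (lagrange_poly c n i) < n"
proof -
  have "degree (lagrange_poly c n i) \<le>
          (\<Sum>k\<in>{1..n} - {i}. degree (smult (1 / (c i - c k)) [:- c k, 1:]))"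
    unfolding lagrange_poly_def using degree_prod_sum_le[OF finite_Diff[OF finite_atLeastAtMost]]
    by (simp only: o_def)
  also have "\<dots> \<le> (\<Sum>k\<in>{1..n} - {i}. 1)"
    by (intro sum_mono) auto
  finally show ?thesis
    using assms by auto
qed

lemma poly_lagrange_poly_node:
  assumes "inj_on c {1..n}" "i \<in> {1..n}" "j \<in> {1..n}"
  shows "poly (lagrange_poly c n i) (c j) = (if i = j then 1 else 0)"
proof (cases "i = j")
  case True
  have "c i \<noteq> c k" if "k \<in> {1..n} - {i}" for k
    using that assms by (auto dest: inj_onD)
  then show ?thesis
    using True by (auto simp: lagrange_poly_def poly_prod simp flip: diff_divide_distrib intro!: prod.neutral)
next
  case False
  then show ?thesis
    using assms by (auto simp: lagrange_poly_def poly_prod intro!: bexI[of _ j])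
qed

text \<open>Both sides have degree below \<open>n\<close> and agree at the \<open>n\<close> distinct
  nodes.\<close>

lemma lagrange_interpolation:
  assumes "inj_on c {1..n}" "degree p < n"
  shows "p = (\<Sum>i=1..n. smult (poly p (c i)) (lagrange_poly c n i))"
proof (rule poly_eqI_degree)
  let ?q = "\<Sum>i=1..n. smult (poly p (c i)) (lagrange_poly c n i)"
  have card: "card (c ` {1..n}) = n"
    using assms by (simp add: card_image)
  show "poly p x = poly ?q x" if x: "x \<in> c ` {1..n}" for x
  proof -
    obtain j where j: "j \<in> {1..n}" "x = c j"
      using x by blast
    have "poly ?q x = (\<Sum>i=1..n. if i = j then poly p (c j) else 0)"
      unfolding poly_sum using assms(1) j
      by (intro sum.cong) (auto simp: poly_lagrange_poly_node)
    then show ?thesis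
      using j by simp
  qed
  show "degree p < card (c ` {1..n})"
    using assms card by simp
  have "degree (smult a (lagrange_poly c n i)) \<le> n - 1" if "i \<in> {1..n}" for a i
    using degree_lagrange_poly[OF that, of c] degree_smult_le[of a "lagrange_poly c n i"] by linarith
  then have "degree ?q \<le> n - 1"
    by (intro degree_sum_le) auto
  then show "degree ?q < card (c ` {1..n})"
    using assms card by simp
qed

lemma quad_weight_eq_poly: "quad_weight c n i = poly (antideriv_poly (lagrange_poly c n i)) 1"
  by (simp add: quad_weight_def lagrange_basis_eq_poly integral_poly_antideriv_poly)

lemma colloc_coeff_eq_poly: "colloc_coeff c n j k = poly (antideriv_poly (lagrange_poly c n k)) (c j)"
  by (simp add: colloc_coeff_def lagrange_basis_eq_poly interval_integral_poly)

subsection \<open>Gauss--Legendre nodes\<close>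

lemma higher_pderiv_pcompose_linear:
  "(pderiv ^^ n) (pcompose p [:a, b:]) = smult (b ^ n) (pcompose ((pderiv ^^ n) p) [:a, b:])"
  for p :: "real poly"
  by (induction n) (auto simp: pderiv_smult pderiv_pcompose pderiv_pCons algebra_simps)

text \<open>Substituting 2x - 1 turns x^2 - 1 into 4x(x - 1), and each derivative contributes a
  factor 2. Of the resulting constant only its nonvanishing matters later.\<close>

lemma shifted_legendre_rodrigues:
  obtains \<kappa> where "\<kappa> \<noteq> 0"
    "shifted_legendre_poly n = smult \<kappa> ((pderiv ^^ n) (([:0, 1:] * [:-1, 1:]) ^ n))"
proof
  let ?W = "[:0, 1:] * [:-1, 1:] :: real poly"
  have "pcompose ([:-1, 0, 1:] ^ n) [:-1, 2:] = pcompose [:-1, 0, 1:] [:-1, 2 :: real:] ^ n"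
    by (induction n) (simp_all only: power_0 power_Suc pcompose_1 pcompose_mult)
  also have "pcompose [:-1, 0, 1:] [:-1, 2:] = smult 4 ?W"
    by (simp add: pcompose_pCons)
  finally have "pcompose ([:-1, 0, 1:] ^ n) [:-1, 2:] = smult (4 ^ n) (?W ^ n)"
    by (simp only: smult_power)
  then have eq: "smult (4 ^ n) ((pderiv ^^ n) (?W ^ n)) =
        smult (2 ^ n) (pcompose ((pderiv ^^ n) ([:-1, 0, 1:] ^ n)) [:-1, 2:])"
    using higher_pderiv_pcompose_linear[of n "[:-1, 0, 1:] ^ n" "-1" 2]
    by (simp only: higher_pderiv_smult)
  have "pcompose ((pderiv ^^ n) ([:-1, 0, 1:] ^ n)) [:-1, 2:] =
      smult (1 / 2 ^ n) (smult (4 ^ n) ((pderiv ^^ n) (?W ^ n)))"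
    unfolding eq by simp
  then show "shifted_legendre_poly n =
      smult (1 / (2 ^ n * fact n) * (1 / 2 ^ n * 4 ^ n)) ((pderiv ^^ n) (?W ^ n))"
    by (simp only: shifted_legendre_poly_def legendre_poly_def pcompose_smult smult_smult)
qed simp

lemma power_Suc_dvd_imp_power_dvd_pderiv:
  fixes p :: "real poly"
  assumes "x ^ Suc n dvd p"
  shows "x ^ n dvd pderiv p"
proof -
  obtain q where q: "p = x ^ Suc n * q"
    using assms by auto
  have "pderiv p = x ^ n * (x * pderiv q + smult (of_nat (Suc n)) (q * pderiv x))"
    unfolding q pderiv_mult pderiv_power_Suc by (simp add: algebra_simps del: of_nat_Suc)
  then show ?thesis
    by simp
qed

lemma power_dvd_higher_pderiv:
  fixes p :: "real poly"
  assumes "x ^ (m + n) dvd p"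
  shows "x ^ m dvd (pderiv ^^ n) p"
  using assms
proof (induction n arbitrary: m)
  case (Suc n)
  then have "x ^ Suc m dvd (pderiv ^^ n) p"
    by (intro Suc.IH) (simp only: add_Suc_right add_Suc)
  then show ?case
    by (simp only: funpow.simps o_apply power_Suc_dvd_imp_power_dvd_pderiv)
qed (simp only: funpow_0 add_0_right)

text \<open>Repeated integration by parts: the multiple zeros of \<open>p\<close> at 0 and 1 kill
  all boundary terms, and \<open>n\<close> derivatives annihilate \<open>q\<close>.\<close>

lemma integral_higher_pderiv_mult_eq_0:
  fixes p :: "real poly"
  assumes "[:0, 1:] ^ n dvd p" "[:-1, 1:] ^ n dvd p" "degree q < n"
  shows "integral {0..1} (poly ((pderiv ^^ n) p * q)) = 0"
  using assms
proof (induction n arbitrary: q)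
  case (Suc n)
  let ?p = "(pderiv ^^ n) p"
  \<comment> \<open>Zeros of order at least \<open>Suc n\<close> at both ends survive
    \<open>n\<close> derivatives with order at least 1.\<close>
  have "[:- 0, 1:] ^ 1 dvd ?p" "[:- 1, 1:] ^ 1 dvd ?p"
    using Suc.prems by (intro power_dvd_higher_pderiv; simp)+
  then have "poly ?p 0 = 0" "poly ?p 1 = 0"
    by (simp_all only: power_one_right poly_eq_0_iff_dvd)
  then have "integral {0..1} (poly ((pderiv ^^ Suc n) p * q)) = - integral {0..1} (poly (?p * pderiv q))"
    using integral_poly_by_parts[of ?p q] by simp
  also have "integral {0..1} (poly (?p * pderiv q)) = 0"
  \<comment> \<open>A constant \<open>q\<close> is treated apart: its derivative also has degree 0,
    which is not below \<open>n\<close> when \<open>n = 0\<close>, so the induction hypothesis could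
    not be applied.\<close>
  proof (cases "degree q = 0")
    case True
    then have "poly (?p * pderiv q) = (\<lambda>_. 0)"
      by (simp add: fun_eq_iff pderiv_eq_0_iff[THEN iffD2])
    then show ?thesis
      by simp
  next
    case False
    show ?thesis
    proof (rule Suc.IH)
      show "[:0, 1:] ^ n dvd p" "[:- 1, 1:] ^ n dvd p"
        using Suc.prems by (meson dvd_trans le_imp_power_dvd le_Suc_eq order_refl)+
      show "degree (pderiv q) < n"
        using False Suc.prems by (simp add: degree_pderiv)
    qed
  qed
  finally show ?case
    by simp
qed simp

lemma shifted_legendre_orthogonal:
  assumes "degree q < n"
  shows "integral {0..1} (poly (shifted_legendre_poly n * q)) = 0"
proof -
  obtain \<kappa> where \<kappa>: "\<kappa> \<noteq> 0"
    "shifted_legendre_poly n = smult \<kappa> ((pderiv ^^ n) (([:0, 1:] * [:-1, 1:]) ^ n))"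
    using shifted_legendre_rodrigues .
  have "integral {0..1} (poly ((pderiv ^^ n) (([:0, 1:] * [:-1, 1:]) ^ n) * smult \<kappa> q)) = 0"
    using assms by (intro integral_higher_pderiv_mult_eq_0)
      (simp_all only: power_mult_distrib dvd_triv_left dvd_triv_right le_less_trans[OF degree_smult_le])
  then show ?thesis
    by (simp only: \<kappa> mult_smult_left mult_smult_right)
qed

lemma degree_shifted_legendre: "degree (shifted_legendre_poly n) = n"
proof -
  obtain \<kappa> where \<kappa>: "\<kappa> \<noteq> 0"
    "shifted_legendre_poly n = smult \<kappa> ((pderiv ^^ n) (([:0, 1:] * [:-1, 1:]) ^ n))"
    using shifted_legendre_rodrigues .
  have "degree (([:0, 1:] * [:-1, 1:] :: real poly) ^ n) = 2 * n"
    by (subst degree_power_eq) auto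
  then show ?thesis
    using \<kappa> by (simp only: degree_smult_eq degree_higher_pderiv) simp
qed

text \<open>In characteristic 0 a derivative lowers a positive order by exactly one. Nonvanishing is
  carried through the induction because \<open>order\<close> is meaningful only for nonzero
  polynomials.\<close>

lemma order_higher_pderiv:
  fixes p :: "real poly"
  assumes "p \<noteq> 0" "n \<le> order a p"
  shows "(pderiv ^^ n) p \<noteq> 0 \<and> order a ((pderiv ^^ n) p) = order a p - n"
  using assms(2)
proof (induction n)
  case (Suc n)
  let ?q = "(pderiv ^^ n) p"
  have q: "?q \<noteq> 0" "order a ?q = order a p - n"
    using Suc by auto
  then have root: "poly ?q a = 0"
    using Suc.prems by (auto simp: order_root)
  then have "degree ?q \<noteq> 0"
    using q(1) by (metis degree_eq_zeroE poly_pCons poly_0 mult_zero_right add_0_right pCons_0_0)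
  then show ?case
    using q root order_pderiv[of ?q a] by (auto simp: pderiv_eq_0_iff)
qed (use assms in auto)

text \<open>The polynomial (x(x - 1))^n has a zero of order exactly \<open>n\<close> at 0, which
  \<open>n\<close> derivatives use up. Hence Gauss nodes are nonzero and one may divide by
  them.\<close>

lemma poly_shifted_legendre_0: "poly (shifted_legendre_poly n) 0 \<noteq> 0"
proof -
  obtain \<kappa> where \<kappa>: "\<kappa> \<noteq> 0"
    "shifted_legendre_poly n = smult \<kappa> ((pderiv ^^ n) (([:0, 1:] * [:-1, 1:]) ^ n))"
    using shifted_legendre_rodrigues .
  let ?W = "[:0, 1:] * [:-1, 1:] :: real poly"
  have "order 0 (([:- 0, 1:] :: real poly) ^ n) = n"
    by (rule order_power_n_n)
  moreover have "order 0 ([:-1, 1:] ^ n :: real poly) = 0"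
    by (simp add: order_0I)
  ultimately have "order 0 (?W ^ n) = n"
    by (simp only: power_mult_distrib) (subst order_mult; simp)
  moreover have "?W ^ n \<noteq> 0"
    by simp
  ultimately have "(pderiv ^^ n) (?W ^ n) \<noteq> 0 \<and> order 0 ((pderiv ^^ n) (?W ^ n)) = 0"
    using order_higher_pderiv[of "?W ^ n" n 0] by simp
  then have "poly ((pderiv ^^ n) (?W ^ n)) 0 \<noteq> 0"
    by (metis order_root)
  then show ?thesis
    using \<kappa> by (simp only: poly_smult) simp
qed

context
  fixes c :: "nat \<Rightarrow> real" and r :: nat
  assumes nodes: "gauss_legendre_nodes r c"
begin

lemma gauss_inj: "inj_on c {1..r}"
  using nodes by (auto simp: gauss_legendre_nodes_def bij_betw_def)

lemma gauss_root: "j \<in> {1..r} \<Longrightarrow> poly (shifted_legendre_poly r) (c j) = 0"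
  using nodes by (auto simp: gauss_legendre_nodes_def bij_betw_def)

text \<open>Divide \<open>p\<close> by the shifted Legendre polynomial: the quotient has degree
  below \<open>r\<close>, so its product with that polynomial integrates to 0; the remainder is
  integrated exactly by interpolation and agrees with \<open>p\<close> at the nodes.\<close>

lemma gauss_quadrature_exact:
  assumes "degree p < 2 * r"
  shows "integral {0..1} (poly p) = (\<Sum>m=1..r. quad_weight c r m * poly p (c m))"
proof -
  define P where "P = shifted_legendre_poly r"
  have P: "P \<noteq> 0" "degree P = r"
    using poly_shifted_legendre_0[of r] by (auto simp: P_def degree_shifted_legendre)
  define Q R where "Q = p div P" and "R = p mod P"
  have p: "p = P * Q + R"
    by (simp add: Q_def R_def)
  have R: "degree R < r"
    using P assms degree_mod_less'[of P p] by (cases "R = 0") (auto simp: R_def)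
  have Q: "degree Q < r"
  proof (cases "Q = 0")
    case False
    have "degree (p - R) < 2 * r"
      using assms R by (intro degree_diff_less) auto
    moreover have "degree (p - R) = r + degree Q"
      using False P by (simp add: p degree_mult_eq)
    ultimately show ?thesis
      by simp
  \<comment> \<open>The zero quotient has degree 0, and \<open>degree R < r\<close> forces
    \<open>r\<close> to be positive.\<close>
  qed (use R in simp)
  have eqR: "poly R (c m) = poly p (c m)" if "m \<in> {1..r}" for m
    using gauss_root[OF that] by (simp add: p P_def)
  have "integral {0..1} (poly p) = integral {0..1} (\<lambda>x. poly (P * Q) x + poly R x)"
    by (intro arg_cong[where f = "integral {0..1}"]) (simp add: p fun_eq_iff)
  also have "\<dots> = integral {0..1} (poly (P * Q)) + integral {0..1} (poly R)"
    by (intro Henstock_Kurzweil_Integration.integral_add poly_integrable)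
  also have "integral {0..1} (poly (P * Q)) = 0"
    unfolding P_def by (rule shifted_legendre_orthogonal[OF Q])
  also have "poly R = (\<lambda>x. \<Sum>m=1..r. poly R (c m) * poly (lagrange_poly c r m) x)"
    by (subst lagrange_interpolation[OF gauss_inj R]) (simp add: fun_eq_iff poly_sum)
  also have "integral {0..1} \<dots> = (\<Sum>m=1..r. poly R (c m) * integral {0..1} (poly (lagrange_poly c r m)))"
    by (subst integral_sum) (auto intro!: integrable_continuous_real continuous_intros)
  finally show ?thesis
    by (simp add: eqR quad_weight_def lagrange_basis_eq_poly mult.commute)
qed

text \<open>The symplecticity condition. Quadrature is exact for the derivative of
  \<open>L j * L k\<close>, of degree below 2r; the integral is the product of the values at 1, and
  at the nodes \<open>pderiv (L j)\<close> is the Lagrange polynomial, so one term per factor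
  survives.\<close>

lemma gauss_symplectic:
  assumes "j \<in> {1..r}" "k \<in> {1..r}"
  shows "quad_weight c r j * colloc_coeff c r j k + quad_weight c r k * colloc_coeff c r k j =
           quad_weight c r j * quad_weight c r k"
proof -
  define L where "L i = antideriv_poly (lagrange_poly c r i)" for i
  have deg: "degree (L i) \<le> r" if "i \<in> {1..r}" for i
    using degree_antideriv_poly[of "lagrange_poly c r i"] degree_lagrange_poly[OF that, of c]
    by (simp add: L_def)
  have "degree (L j * L k) \<le> r + r"
    using degree_mult_le[of "L j" "L k"] deg[OF assms(1)] deg[OF assms(2)] by linarith
  then have "degree (pderiv (L j * L k)) < 2 * r"
    using assms by (auto simp: degree_pderiv)
  then have "integral {0..1} (poly (pderiv (L j * L k))) =
      (\<Sum>m=1..r. quad_weight c r m * poly (pderiv (L j * L k)) (c m))"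
    by (rule gauss_quadrature_exact)
  also have "\<dots> = (\<Sum>m=1..r. (if m = j then quad_weight c r j * poly (L k) (c j) else 0) +
                       (if m = k then quad_weight c r k * poly (L j) (c k) else 0))"
    using assms
    by (intro sum.cong) (auto simp: pderiv_mult L_def poly_lagrange_poly_node[OF gauss_inj])
  also have "\<dots> = quad_weight c r j * colloc_coeff c r j k + quad_weight c r k * colloc_coeff c r k j"
    using assms by (simp add: sum.distrib colloc_coeff_eq_poly L_def)
  also have "integral {0..1} (poly (pderiv (L j * L k))) = quad_weight c r j * quad_weight c r k"
    using integral_unique[OF integral_poly_pderiv[of 0 1 "L j * L k"]]
    by (simp add: quad_weight_eq_poly L_def)
  finally show ?thesis
    by simp
qed

text \<open>If \<open>q\<close> has degree at most \<open>r\<close> and \<open>q(0) = 0\<close>, then \<open>q(x) / x\<close> interpolates the values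
  \<open>q(c\<^sub>j) / c\<^sub>j\<close>; so the antiderivatives of the Lagrange polynomials, and with them their values at the
  nodes, can be recovered from \<open>colloc_coeff\<close>.\<close>

lemma gauss_colloc_coeff_left_inverse:
  obtains B where "\<And>k m. k \<in> {1..r} \<Longrightarrow> m \<in> {1..r} \<Longrightarrow>
    (\<Sum>j=1..r. B m j * colloc_coeff c r j k) = (if k = m then 1 else 0)"
proof
  \<comment> \<open>The basis for interpolation at the nodes together with 0, restricted to
    polynomials vanishing at 0. The inverse \<open>B m j\<close> is the derivative of
    \<open>q j\<close> at \<open>c m\<close>.\<close>
  define q where "q j = smult (1 / c j) ([:0, 1:] * lagrange_poly c r j)" for j
  fix k m assume km: "k \<in> {1..r}" "m \<in> {1..r}"
  define L where "L = antideriv_poly (lagrange_poly c r k)"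
  obtain g where g: "L = [:0, 1:] * g"
    using poly_antideriv_poly_0[of "lagrange_poly c r k"] poly_eq_0_iff_dvd[of L 0]
    by (auto simp: L_def)
  have nz: "c j \<noteq> 0" if "j \<in> {1..r}" for j
    using gauss_root[OF that] poly_shifted_legendre_0[of r] by metis
  have "degree L \<le> r"
    using degree_antideriv_poly[of "lagrange_poly c r k"] degree_lagrange_poly[OF km(1), of c]
    by (simp add: L_def)
  then have "degree g < r"
    using km by (cases "g = 0") (auto simp: g degree_mult_eq)
  then have "g = (\<Sum>j=1..r. smult (poly g (c j)) (lagrange_poly c r j))"
    by (rule lagrange_interpolation[OF gauss_inj])
  then have "L = [:0, 1:] * (\<Sum>j=1..r. smult (poly g (c j)) (lagrange_poly c r j))"
    using g by (simp only:)
  also have "\<dots> = (\<Sum>j=1..r. [:0, 1:] * smult (poly g (c j)) (lagrange_poly c r j))"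
    by (rule sum_distrib_left)
  also have "\<dots> = (\<Sum>j=1..r. smult (colloc_coeff c r j k) (q j))"
  proof (intro sum.cong refl)
    fix j assume "j \<in> {1..r}"
    then have "poly g (c j) = colloc_coeff c r j k * (1 / c j)"
      using nz g by (simp add: colloc_coeff_eq_poly flip: L_def)
    then show "[:0, 1:] * smult (poly g (c j)) (lagrange_poly c r j) = smult (colloc_coeff c r j k) (q j)"
      by (simp only: q_def mult_smult_right smult_smult)
  qed
  finally have "poly (pderiv L) (c m) =
      (\<Sum>j=1..r. poly (pderiv (q j)) (c m) * colloc_coeff c r j k)"
    by (simp add: pderiv_sum pderiv_smult poly_sum mult.commute)
  then show "(\<Sum>j=1..r. poly (pderiv (q j)) (c m) * colloc_coeff c r j k) = (if k = m then 1 else 0)"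
    using km by (simp add: L_def poly_lagrange_poly_node[OF gauss_inj])
qed

end

subsection \<open>Integrability\<close>

text \<open>The second mean value theorem yields existence of the integral of the product along with
  its value.\<close>

lemma integrable_on_increasing_mult:
  fixes f g :: "real \<Rightarrow> real"
  assumes "f integrable_on {a..b}" "\<And>x y. a \<le> x \<Longrightarrow> x \<le> y \<Longrightarrow> y \<le> b \<Longrightarrow> g x \<le> g y"
  shows "(\<lambda>x. g x * f x) integrable_on {a..b}"
proof (cases "a \<le> b")
  case True
  show ?thesis
    by (rule second_mean_value_theorem_full[OF assms(1) True assms(2)]) (auto intro: has_integral_integrable)
qed auto

text \<open>Henstock--Kurzweil integrability need not be absolute, so the factor must have bounded variation:
  a polynomial is a difference of two increasing functions.\<close>

lemma integrable_on_poly_scaleR: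
  fixes f :: "real \<Rightarrow> 'a::euclidean_space"
  assumes f: "f integrable_on {a..b}"
  shows "(\<lambda>x. poly p x *\<^sub>R f x) integrable_on {a..b}"
proof (subst integrable_componentwise_iff, intro ballI)
  fix e :: 'a assume "e \<in> Basis"
  with f have fe: "(\<lambda>x. f x \<bullet> e) integrable_on {a..b}"
    by (subst (asm) integrable_componentwise_iff) auto
  \<comment> \<open>With \<open>C\<close> bounding |p'|, the function p + C x is increasing;
    subtracting C x, a multiple of the increasing function x, recovers p.\<close>
  have "bounded (poly (pderiv p) ` {a..b})"
    by (intro compact_imp_bounded compact_continuous_image continuous_intros compact_Icc)
  then obtain C where C: "\<bar>poly (pderiv p) x\<bar> \<le> C" if "x \<in> {a..b}" for x
    unfolding bounded_iff by force
  have mono: "poly p x + C * x \<le> poly p y + C * y" if "a \<le> x" "x \<le> y" "y \<le> b" for x y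
  proof (rule deriv_nonneg_imp_mono[where g = "\<lambda>x. poly p x + C * x" and g' = "\<lambda>x. poly (pderiv p) x + C"])
    show "((\<lambda>x. poly p x + C * x) has_real_derivative poly (pderiv p) z + C) (at z)" for z
      by (auto intro!: derivative_eq_intros)
    show "0 \<le> poly (pderiv p) z + C" if "z \<in> {x..y}" for z
      using C[of z] that \<open>a \<le> x\<close> \<open>y \<le> b\<close> by auto
  qed (use that in auto)
  have "(\<lambda>x. (poly p x + C * x) * (f x \<bullet> e)) integrable_on {a..b}"
    by (rule integrable_on_increasing_mult[OF fe mono])
  moreover have "(\<lambda>x. C * (x * (f x \<bullet> e))) integrable_on {a..b}"
    by (intro integrable_on_mult_right integrable_on_increasing_mult[OF fe])
  ultimately have "(\<lambda>x. (poly p x + C * x) * (f x \<bullet> e) - C * (x * (f x \<bullet> e))) integrable_on {a..b}"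
    by (rule integrable_diff)
  then show "(\<lambda>x. poly p x *\<^sub>R f x \<bullet> e) integrable_on {a..b}"
    by (simp add: algebra_simps)
qed

lemma polynomial_function_integrable:
  fixes f :: "real \<Rightarrow> 'a::euclidean_space"
  shows "polynomial_function f \<Longrightarrow> f integrable_on {a..b}"
  by (intro integrable_continuous_real continuous_on_polymonial_function)

subsection \<open>Gradients\<close>

text \<open>Since \<open>gradient\<close> is a definite description, a vector representing the
  derivative is built from its values on \<open>Basis\<close> and shown to be unique.\<close>

lemma has_derivative_gradient:
  fixes f :: "'a::euclidean_space \<Rightarrow> real"
  assumes "f differentiable (at x)"
  shows "(f has_derivative (\<lambda>h. h \<bullet> gradient f x)) (at x)"
proof -
  obtain f' where f': "(f has_derivative f') (at x)"
    using assms by (auto simp: differentiable_def)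
  interpret bounded_linear f'
    using f' by (rule has_derivative_bounded_linear)
  define D where "D = (\<Sum>e\<in>Basis. f' e *\<^sub>R e)"
  have "f' h = h \<bullet> D" for h
    by (subst euclidean_representation[of h, symmetric]) (simp add: sum scaleR D_def inner_sum_right mult.commute)
  then have "f' = (\<lambda>h. h \<bullet> D)" ..
  with f' have D: "GDERIV f x :> D"
    by (simp add: gderiv_def)
  have "D' = D" if "GDERIV f x :> D'" for D'
    using has_derivative_unique[OF that[unfolded gderiv_def] D[unfolded gderiv_def]]
    by (metis vector_eq_ldot)
  with D have "gradient f x = D"
    unfolding gradient_def by (rule the_equality)
  with D show ?thesis
    by (simp add: gderiv_def)
qed

lemma smooth_fun_differentiable: "smooth_fun f \<Longrightarrow> f differentiable (at x)"
  unfolding smooth_fun_def by (drule spec[of _ "Suc 0"]) simp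

subsection \<open>Continuous Runge--Kutta averages\<close>

lemma crk_avg_cong: "(\<And>\<tau>. \<tau> \<in> {0..1} \<Longrightarrow> f \<tau> = g \<tau>) \<Longrightarrow> crk_avg c s i f = crk_avg c s i g"
  unfolding crk_avg_def
  by (intro arg_cong[where f = "\<lambda>x. _ *\<^sub>R x"] Henstock_Kurzweil_Integration.integral_cong) auto

lemma crk_avg_bounded_linear:
  assumes "bounded_linear h" "f integrable_on {0..1}"
  shows "crk_avg c s i (\<lambda>\<tau>. h (f \<tau>)) = h (crk_avg c s i f)"
proof -
  interpret bounded_linear h by fact
  show ?thesis
    using integral_linear[OF integrable_on_poly_scaleR[OF assms(2), of "lagrange_poly c s i"] assms(1)]
    by (simp add: crk_avg_def lagrange_basis_eq_poly o_def scaleR)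
qed

lemma crk_avg_add:
  assumes "f integrable_on {0..1}" "g integrable_on {0..1}"
  shows "crk_avg c s i (\<lambda>\<tau>. f \<tau> + g \<tau>) = crk_avg c s i f + crk_avg c s i g"
  using assms
  by (simp add: crk_avg_def lagrange_basis_eq_poly scaleR_add_right integrable_on_poly_scaleR
      Henstock_Kurzweil_Integration.integral_add)

lemma crk_avg_scaleR: "crk_avg c s i (\<lambda>\<tau>. a *\<^sub>R f \<tau>) = a *\<^sub>R crk_avg c s i f"
proof -
  have "integral {0..1} (\<lambda>\<tau>. lagrange_basis c s i \<tau> *\<^sub>R a *\<^sub>R f \<tau>) =
          integral {0..1} (\<lambda>\<tau>. a *\<^sub>R lagrange_basis c s i \<tau> *\<^sub>R f \<tau>)"
    by (simp only: scaleR_left_commute)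
  then show ?thesis
    by (simp only: crk_avg_def integral_cmul scaleR_left_commute[of _ a])
qed

lemma crk_avg_sum:
  assumes "finite A" "\<And>k. k \<in> A \<Longrightarrow> f k integrable_on {0..1}"
  shows "crk_avg c s i (\<lambda>\<tau>. \<Sum>k\<in>A. f k \<tau>) = (\<Sum>k\<in>A. crk_avg c s i (f k))"
  using assms
  by (simp add: crk_avg_def lagrange_basis_eq_poly scaleR_sum_right integrable_on_poly_scaleR integral_sum)

text \<open>Averaging is linear, so the spatial Runge-Kutta relations pass from functions of \<tau>
  to their averages.\<close>

lemma crk_avg_rk_step:
  fixes r :: nat
  assumes "\<And>\<tau>. \<tau> \<in> {0..1} \<Longrightarrow> f \<tau> = g \<tau> + h *\<^sub>R (\<Sum>k=1..r. a k *\<^sub>R v k \<tau>)"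
    and "g integrable_on {0..1}" "\<And>k. k \<in> {1..r} \<Longrightarrow> v k integrable_on {0..1}"
  shows "crk_avg c s i f = crk_avg c s i g + h *\<^sub>R (\<Sum>k=1..r. a k *\<^sub>R crk_avg c s i (v k))"
proof -
  have v: "(\<lambda>\<tau>. a k *\<^sub>R v k \<tau>) integrable_on {0..1}" if "k \<in> {1..r}" for k
    using assms(3)[OF that] by (rule integrable_cmul)
  have "crk_avg c s i f = crk_avg c s i (\<lambda>\<tau>. g \<tau> + h *\<^sub>R (\<Sum>k=1..r. a k *\<^sub>R v k \<tau>))"
    by (rule crk_avg_cong) (fact assms(1))
  also have "\<dots> = crk_avg c s i g + crk_avg c s i (\<lambda>\<tau>. h *\<^sub>R (\<Sum>k=1..r. a k *\<^sub>R v k \<tau>))"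
    by (intro crk_avg_add assms(2) integrable_cmul integrable_sum v) auto
  finally show ?thesis
    by (simp only: crk_avg_scaleR crk_avg_sum[OF finite_atLeastAtMost v])
qed

text \<open>The kernel is separable in \<tau> and \<sigma>, so the integral sees \<open>f\<close>
  only through its \<open>s\<close> averages.\<close>

lemma integral_crk_A:
  assumes "f integrable_on {0..1}"
  shows "integral {0..1} (\<lambda>\<sigma>. crk_A c s \<tau> \<sigma> *\<^sub>R f \<sigma>) =
           (\<Sum>i=1..s. poly (antideriv_poly (lagrange_poly c s i)) \<tau> *\<^sub>R crk_avg c s i f)"
proof -
  let ?l = "lagrange_poly c s"
  let ?a = "\<lambda>i. 1 / quad_weight c s i * poly (antideriv_poly (?l i)) \<tau>"
  have "integral {0..1} (\<lambda>\<sigma>. crk_A c s \<tau> \<sigma> *\<^sub>R f \<sigma>) =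
          integral {0..1} (\<lambda>\<sigma>. \<Sum>i=1..s. ?a i *\<^sub>R (poly (?l i) \<sigma> *\<^sub>R f \<sigma>))"
    by (simp add: crk_A_def lagrange_basis_eq_poly interval_integral_poly scaleR_sum_left)
  also have "\<dots> = (\<Sum>i=1..s. ?a i *\<^sub>R integral {0..1} (\<lambda>\<sigma>. poly (?l i) \<sigma> *\<^sub>R f \<sigma>))"
    by (subst integral_sum)
       (simp_all only: finite_atLeastAtMost integral_cmul integrable_cmul integrable_on_poly_scaleR[OF assms])
  finally show ?thesis
    by (simp add: crk_avg_def lagrange_basis_eq_poly)
qed

text \<open>By separability of the kernel, \<open>f\<close> is on [0,1] a combination of
  antiderivatives of Lagrange polynomials. The derivative is one-sided at the ends because the
  equation is known only on [0,1].\<close>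

lemma crk_has_vector_derivative:
  assumes f: "\<And>\<tau>. \<tau> \<in> {0..1} \<Longrightarrow> f \<tau> = f 0 + h *\<^sub>R integral {0..1} (\<lambda>\<sigma>. crk_A c s \<tau> \<sigma> *\<^sub>R g \<sigma>)"
    and g: "g integrable_on {0..1}" and \<tau>: "\<tau> \<in> {0..1}"
  shows "(f has_vector_derivative (\<Sum>i=1..s. poly (lagrange_poly c s i) \<tau> *\<^sub>R (h *\<^sub>R crk_avg c s i g)))
           (at \<tau> within {0..1})"
proof (rule has_vector_derivative_transform[OF \<tau>])
  let ?L = "\<lambda>i. antideriv_poly (lagrange_poly c s i)"
  show "f x = f 0 + (\<Sum>i=1..s. poly (?L i) x *\<^sub>R (h *\<^sub>R crk_avg c s i g))" if "x \<in> {0..1}" for x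
    unfolding f[OF that] integral_crk_A[OF g] by (simp add: scaleR_sum_right mult.commute)
  have L: "((\<lambda>x. poly (?L i) x *\<^sub>R v) has_vector_derivative poly (lagrange_poly c s i) \<tau> *\<^sub>R v)
      (at \<tau> within {0..1})" for i v
    by (rule has_vector_derivative_scaleR[THEN has_vector_derivative_eq_rhs])
       (use poly_DERIV[of "?L i" \<tau>] in \<open>auto intro: has_field_derivative_at_within\<close>)
  show "((\<lambda>x. f 0 + (\<Sum>i=1..s. poly (?L i) x *\<^sub>R (h *\<^sub>R crk_avg c s i g))) has_vector_derivative
        (\<Sum>i=1..s. poly (lagrange_poly c s i) \<tau> *\<^sub>R (h *\<^sub>R crk_avg c s i g))) (at \<tau> within {0..1})"
    by (rule has_vector_derivative_add[OF has_vector_derivative_const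
        has_vector_derivative_sum[OF L], THEN has_vector_derivative_eq_rhs]) simp
qed

text \<open>The definition of the average read backwards, \<open>quad_weight c s i\<close> being
  nonzero. This produces the weighted sums of averages that occur in the flux.\<close>

lemma has_integral_inner_lagrange_sum:
  fixes g :: "real \<Rightarrow> 'a::euclidean_space"
  assumes "g integrable_on {0..1}" "\<And>i. i \<in> {1..s} \<Longrightarrow> quad_weight c s i \<noteq> 0"
  shows "((\<lambda>\<tau>. g \<tau> \<bullet> (\<Sum>i=1..s. poly (lagrange_poly c s i) \<tau> *\<^sub>R v i)) has_integral
            (\<Sum>i=1..s. quad_weight c s i * (crk_avg c s i g \<bullet> v i))) {0..1}"
proof -
  have "((\<lambda>\<tau>. (poly (lagrange_poly c s i) \<tau> *\<^sub>R g \<tau>) \<bullet> v i) has_integral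
          (quad_weight c s i *\<^sub>R crk_avg c s i g) \<bullet> v i) {0..1}" if "i \<in> {1..s}" for i
    using has_integral_linear[OF integrable_integral[OF
          integrable_on_poly_scaleR[OF assms(1), of "lagrange_poly c s i"]]
        bounded_linear_inner_left[of "v i"]] assms(2)[OF that]
    by (simp add: crk_avg_def lagrange_basis_eq_poly o_def)
  then have "((\<lambda>\<tau>. \<Sum>i=1..s. (poly (lagrange_poly c s i) \<tau> *\<^sub>R g \<tau>) \<bullet> v i) has_integral
          (\<Sum>i=1..s. (quad_weight c s i *\<^sub>R crk_avg c s i g) \<bullet> v i)) {0..1}"
    by (intro has_integral_sum finite_atLeastAtMost)
  then show ?thesis
    by (simp add: inner_sum_right)
qed

text \<open>In each coordinate the combination is a polynomial with infinitely many roots, hence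
  zero; its derivative at \<open>c m\<close> isolates \<open>v m\<close>.\<close>

lemma antideriv_lagrange_independent:
  fixes v :: "nat \<Rightarrow> 'a::euclidean_space"
  assumes "inj_on c {1..s}" "m \<in> {1..s}"
    and "\<And>\<tau>. \<tau> \<in> {0..1} \<Longrightarrow> (\<Sum>i=1..s. poly (antideriv_poly (lagrange_poly c s i)) \<tau> *\<^sub>R v i) = 0"
  shows "v m = 0"
proof (rule euclidean_eqI)
  fix e :: 'a assume "e \<in> Basis"
  define q where "q = (\<Sum>i=1..s. smult (v i \<bullet> e) (antideriv_poly (lagrange_poly c s i)))"
  have "poly q \<tau> = (\<Sum>i=1..s. poly (antideriv_poly (lagrange_poly c s i)) \<tau> *\<^sub>R v i) \<bullet> e" for \<tau>
    by (simp add: q_def poly_sum inner_sum_left mult.commute)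
  then have "{0..1} \<subseteq> {\<tau>. poly q \<tau> = 0}"
    using assms(3) by auto
  moreover have "infinite {0..1::real}"
    by (rule infinite_Icc) simp
  ultimately have "infinite {\<tau>. poly q \<tau> = 0}"
    using finite_subset by blast
  then have "q = 0"
    using poly_roots_finite by blast
  then have "0 = poly (pderiv q) (c m)"
    by simp
  also have "\<dots> = (\<Sum>i=1..s. (v i \<bullet> e) * poly (lagrange_poly c s i) (c m))"
    by (simp add: q_def pderiv_sum pderiv_smult poly_sum)
  also have "\<dots> = (\<Sum>i=1..s. if i = m then v m \<bullet> e else 0)"
    using assms(1,2) by (intro sum.cong) (auto simp: poly_lagrange_poly_node)
  finally show "v m \<bullet> e = 0 \<bullet> e"
    using assms(2) by simp
qed

text \<open>A discrete Leibniz rule: expanding the step gives the double sum of B(X_j, Y_k) with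
  coefficients b_j b_k, which symplecticity splits into the two sums that complete \<open>w\<close>
  to \<open>W j\<close> and \<open>u\<close> to \<open>Z j\<close>.\<close>

lemma symplectic_rk_bilinear:
  fixes r :: nat
  assumes B: "bounded_bilinear B"
    and symp: "\<And>j k. j \<in> {1..r} \<Longrightarrow> k \<in> {1..r} \<Longrightarrow> b j * a j k + b k * a k j = b j * (b k :: real)"
    and Z: "\<And>j. j \<in> {1..r} \<Longrightarrow> Z j = u + h *\<^sub>R (\<Sum>k=1..r. a j k *\<^sub>R X k)"
    and W: "\<And>j. j \<in> {1..r} \<Longrightarrow> W j = w + h *\<^sub>R (\<Sum>k=1..r. a j k *\<^sub>R Y k)"
    and u1: "u1 = u + h *\<^sub>R (\<Sum>j=1..r. b j *\<^sub>R X j)"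
    and w1: "w1 = w + h *\<^sub>R (\<Sum>j=1..r. b j *\<^sub>R Y j)"
  shows "B u1 w1 - B u w = h *\<^sub>R (\<Sum>j=1..r. b j *\<^sub>R (B (X j) (W j) + B (Z j) (Y j)))"
proof -
  interpret bounded_bilinear B by fact
  note expand = add_left add_right scaleR_left scaleR_right sum_left sum_right scaleR_add_right
    scaleR_sum_right sum.distrib scaleR_scaleR
  have "B u1 w1 - B u w = (\<Sum>j=1..r. (h * b j) *\<^sub>R B (X j) w) + (\<Sum>j=1..r. (h * b j) *\<^sub>R B u (Y j))
          + (\<Sum>j=1..r. \<Sum>k=1..r. (h * h * (b j * b k)) *\<^sub>R B (X j) (Y k))"
    unfolding u1 w1 by (simp add: expand ac_simps, subst sum.swap, simp add: ac_simps)
  also have "(\<Sum>j=1..r. \<Sum>k=1..r. (h * h * (b j * b k)) *\<^sub>R B (X j) (Y k)) =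
      (\<Sum>j=1..r. \<Sum>k=1..r. (h * h * (b j * a j k)) *\<^sub>R B (X j) (Y k)) +
      (\<Sum>j=1..r. \<Sum>k=1..r. (h * h * (b k * a k j)) *\<^sub>R B (X j) (Y k))"
    unfolding sum.distrib[symmetric] scaleR_left_distrib[symmetric] distrib_left[symmetric]
    by (intro sum.cong refl) (simp add: symp)
  \<comment> \<open>After renaming, the sum over \<open>k\<close> is \<open>Z j - u\<close> in the
    first argument of \<open>B\<close>.\<close>
  also have "(\<Sum>j=1..r. \<Sum>k=1..r. (h * h * (b k * a k j)) *\<^sub>R B (X j) (Y k)) =
      (\<Sum>j=1..r. \<Sum>k=1..r. (h * h * (b j * a j k)) *\<^sub>R B (X k) (Y j))"
    by (rule sum.swap)
  also have "(\<Sum>j=1..r. (h * b j) *\<^sub>R B (X j) w) + (\<Sum>j=1..r. (h * b j) *\<^sub>R B u (Y j)) +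
      ((\<Sum>j=1..r. \<Sum>k=1..r. (h * h * (b j * a j k)) *\<^sub>R B (X j) (Y k)) +
       (\<Sum>j=1..r. \<Sum>k=1..r. (h * h * (b j * a j k)) *\<^sub>R B (X k) (Y j))) =
      (\<Sum>j=1..r. h *\<^sub>R b j *\<^sub>R (B (X j) (W j) + B (Z j) (Y j)))"
    unfolding sum.distrib[symmetric]
    by (intro sum.cong refl) (simp add: Z W expand ac_simps)
  finally show ?thesis
    by (simp add: scaleR_sum_right)
qed

lemma skew_matrix_inner:
  fixes K :: "real^'d^'d"
  assumes "transpose K = - K"
  shows "u \<bullet> (K *v w) = - ((K *v u) \<bullet> w)"
proof -
  have "u \<bullet> (K *v w) = (transpose K *v u) \<bullet> w"
    by (simp add: dot_lmul_matrix)
  also have "transpose K *v u = - (K *v u)"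
    using matrix_vector_mult_diff_rdistrib[of 0 K u] by (simp add: assms)
  finally show ?thesis
    by simp
qed

subsection \<open>Energy conservation\<close>

theorem theorem3p4:
  fixes M K :: "real^'d^'d"
    and S :: "real^'d \<Rightarrow> real \<Rightarrow> real"
    and \<Delta>t \<Delta>x xn :: real
    and r s :: nat
    and ct c :: "nat \<Rightarrow> real"
    and zn zn1 :: "real \<Rightarrow> real^'d"
    and z dtz dxz :: "nat \<Rightarrow> real \<Rightarrow> real^'d"
    and dtzn dtzn1 :: "real \<Rightarrow> real^'d"
    and dxdtz dtdxz :: "nat \<Rightarrow> real \<Rightarrow> real^'d"
  assumes skew_M: "transpose M = - M"
    and skew_K: "transpose K = - K"
    and smooth_S: "\<And>x. smooth_fun (\<lambda>w. S w x)"
    and dt_pos: "\<Delta>t > 0" and dx_pos: "\<Delta>x > 0"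
    and r_pos: "r \<ge> 1" and s_pos: "s \<ge> 1"
    and gauss_nodes: "gauss_legendre_nodes r ct"
    and crk_nodes_distinct: "inj_on c {1..s}"
    and crk_weights_nonzero: "\<And>i. i \<in> {1..s} \<Longrightarrow> quad_weight c s i \<noteq> 0"
    and poly_zn: "polynomial_function zn"
    and poly_zn1: "polynomial_function zn1"
    and poly_z: "\<And>j. j \<in> {1..r} \<Longrightarrow> polynomial_function (z j)"
    and poly_dtz: "\<And>j. j \<in> {1..r} \<Longrightarrow> polynomial_function (dtz j)"
    and poly_dxz: "\<And>j. j \<in> {1..r} \<Longrightarrow> polynomial_function (dxz j)"
    and scheme_t: "\<And>\<tau> j. \<tau> \<in> {0..1} \<Longrightarrow> j \<in> {1..r} \<Longrightarrow>
          z j \<tau> = z j 0 + \<Delta>t *\<^sub>R integral {0..1} (\<lambda>\<sigma>. crk_A c s \<tau> \<sigma> *\<^sub>R dtz j \<sigma>)"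
    and scheme_t1: "\<And>j. j \<in> {1..r} \<Longrightarrow>
          z j 1 = z j 0 + \<Delta>t *\<^sub>R integral {0..1} (\<lambda>\<sigma>. dtz j \<sigma>)"
    and scheme_x: "\<And>\<tau> j. \<tau> \<in> {0..1} \<Longrightarrow> j \<in> {1..r} \<Longrightarrow>
          z j \<tau> = zn \<tau> + \<Delta>x *\<^sub>R (\<Sum>k=1..r. colloc_coeff ct r j k *\<^sub>R dxz k \<tau>)"
    and scheme_x1: "\<And>\<tau>. \<tau> \<in> {0..1} \<Longrightarrow>
          zn1 \<tau> = zn \<tau> + \<Delta>x *\<^sub>R (\<Sum>j=1..r. quad_weight ct r j *\<^sub>R dxz j \<tau>)"
    and scheme_pde: "\<And>\<tau> j. \<tau> \<in> {0..1} \<Longrightarrow> j \<in> {1..r} \<Longrightarrow>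
          M *v dtz j \<tau> + K *v dxz j \<tau> = gradient (\<lambda>w. S w (xn + ct j * \<Delta>x)) (z j \<tau>)"
    \<comment> \<open>the integrals of the auxiliary functions below exist\<close>
    and dtzn_integrable: "dtzn integrable_on {0..1}"
    and dtdxz_integrable: "\<And>j. j \<in> {1..r} \<Longrightarrow> dtdxz j integrable_on {0..1}"
    and aux_tx: "\<And>\<tau> j. \<tau> \<in> {0..1} \<Longrightarrow> j \<in> {1..r} \<Longrightarrow>
          dxz j \<tau> = dxz j 0 + \<Delta>t *\<^sub>R integral {0..1} (\<lambda>\<sigma>. crk_A c s \<tau> \<sigma> *\<^sub>R dtdxz j \<sigma>)"
    and aux_tx1: "\<And>j. j \<in> {1..r} \<Longrightarrow>
          dxz j 1 = dxz j 0 + \<Delta>t *\<^sub>R integral {0..1} (\<lambda>\<sigma>. dtdxz j \<sigma>)"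
    and aux_xt: "\<And>\<tau> j. \<tau> \<in> {0..1} \<Longrightarrow> j \<in> {1..r} \<Longrightarrow>
          dtz j \<tau> = dtzn \<tau> + \<Delta>x *\<^sub>R (\<Sum>k=1..r. colloc_coeff ct r j k *\<^sub>R dxdtz k \<tau>)"
    and aux_xt1: "\<And>\<tau>. \<tau> \<in> {0..1} \<Longrightarrow>
          dtzn1 \<tau> = dtzn \<tau> + \<Delta>x *\<^sub>R (\<Sum>j=1..r. quad_weight ct r j *\<^sub>R dxdtz j \<tau>)"
    and aux_dtzn: "\<And>\<tau>. \<tau> \<in> {0..1} \<Longrightarrow>
          zn \<tau> = zn 0 + \<Delta>t *\<^sub>R integral {0..1} (\<lambda>\<sigma>. crk_A c s \<tau> \<sigma> *\<^sub>R dtzn \<sigma>)"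
  shows "\<Delta>x * (\<Sum>j=1..r. quad_weight ct r j *
              (discrete_energy S K (xn + ct j * \<Delta>x) (z j 1) (dxz j 1)
             - discrete_energy S K (xn + ct j * \<Delta>x) (z j 0) (dxz j 0)))
         + \<Delta>t * (discrete_flux c s K zn1 dtzn1 - discrete_flux c s K zn dtzn) = 0"
proof -
  define l where "l = lagrange_poly c s"
  define L where "L i = antideriv_poly (l i)" for i
  define avg :: "nat \<Rightarrow> (real \<Rightarrow> real^'d) \<Rightarrow> real^'d" where "avg = crk_avg c s"
  define b where "b = quad_weight c s"
  define bt where "bt = quad_weight ct r"
  define a where "a = colloc_coeff ct r"
  define B :: "real^'d \<Rightarrow> real^'d \<Rightarrow> real" where "B u w = u \<bullet> (K *v w)" for u w
  have B: "bounded_bilinear B"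
    unfolding B_def
    by (rule bounded_bilinear.comp[OF bounded_bilinear_inner bounded_linear_ident
          matrix_vector_mul_bounded_linear])
  interpret B: bounded_bilinear B by fact
  have B_skew: "B u w = - B w u" for u w
    using skew_matrix_inner[OF skew_K, of u w] by (simp add: B_def inner_commute)
  have int: "zn integrable_on {0..1}" "\<And>j. j \<in> {1..r} \<Longrightarrow> z j integrable_on {0..1}"
    "\<And>j. j \<in> {1..r} \<Longrightarrow> dtz j integrable_on {0..1}"
    "\<And>j. j \<in> {1..r} \<Longrightarrow> dxz j integrable_on {0..1}"
    using poly_zn poly_z poly_dtz poly_dxz by (auto intro: polynomial_function_integrable)
  obtain C where C: "\<And>k m. k \<in> {1..r} \<Longrightarrow> m \<in> {1..r} \<Longrightarrow>
      (\<Sum>j=1..r. C m j * a j k) = (if k = m then 1 else 0)"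
    using gauss_colloc_coeff_left_inverse[OF gauss_nodes] unfolding a_def by blast
  have C_apply: "(\<Sum>j=1..r. C m j *\<^sub>R (\<Sum>k=1..r. a j k *\<^sub>R v k)) = v m"
    if m: "m \<in> {1..r}" for m and v :: "nat \<Rightarrow> real^'d"
  proof -
    have "(\<Sum>j=1..r. C m j *\<^sub>R (\<Sum>k=1..r. a j k *\<^sub>R v k)) =
            (\<Sum>k=1..r. (\<Sum>j=1..r. C m j * a j k) *\<^sub>R v k)"
      by (simp add: scaleR_sum_right scaleR_sum_left) (rule sum.swap)
    also have "\<dots> = (\<Sum>k=1..r. if k = m then v m else 0)"
      by (intro sum.cong refl) (subst C, use m in auto)
    finally show ?thesis
      using m by simp
  qed

  \<comment> \<open>The functions \<open>dxdtz\<close> are given only through the stage equations;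
    the left inverse \<open>C\<close> expresses them by \<open>dtz\<close> and \<open>dtzn\<close>,
    which are integrable.\<close>
  have int_dxdtz: "dxdtz m integrable_on {0..1}" if m: "m \<in> {1..r}" for m
  proof -
    have eq: "(\<Sum>j=1..r. C m j *\<^sub>R (1 / \<Delta>x) *\<^sub>R (dtz j \<tau> - dtzn \<tau>)) = dxdtz m \<tau>"
      if "\<tau> \<in> {0..1}" for \<tau>
    proof -
      have "(1 / \<Delta>x) *\<^sub>R (dtz j \<tau> - dtzn \<tau>) = (\<Sum>k=1..r. a j k *\<^sub>R dxdtz k \<tau>)" if "j \<in> {1..r}" for j
        using aux_xt[OF \<open>\<tau> \<in> {0..1}\<close> that] dx_pos by (simp add: a_def)
      then show ?thesis
        using C_apply[OF m, of "\<lambda>k. dxdtz k \<tau>"] by simp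
    qed
    have "(\<lambda>\<tau>. \<Sum>j=1..r. C m j *\<^sub>R (1 / \<Delta>x) *\<^sub>R (dtz j \<tau> - dtzn \<tau>)) integrable_on {0..1}"
      by (intro integrable_sum integrable_cmul integrable_diff int dtzn_integrable) auto
    then show ?thesis
      using eq by (subst integrable_cong[where g = "\<lambda>\<tau>. \<Sum>j=1..r. C m j *\<^sub>R (1 / \<Delta>x) *\<^sub>R (dtz j \<tau> - dtzn \<tau>)"]) auto
  qed

  \<comment> \<open>Averages of the spatial relations\<close>
  have avg_z: "avg i (z j) = avg i zn + \<Delta>x *\<^sub>R (\<Sum>k=1..r. a j k *\<^sub>R avg i (dxz k))"
    if "j \<in> {1..r}" for i j
    unfolding avg_def a_def by (rule crk_avg_rk_step) (use scheme_x that int in auto)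
  have avg_zn1: "avg i zn1 = avg i zn + \<Delta>x *\<^sub>R (\<Sum>j=1..r. bt j *\<^sub>R avg i (dxz j))" for i
    unfolding avg_def bt_def by (rule crk_avg_rk_step) (use scheme_x1 int in auto)
  have avg_dtz: "avg i (dtz j) = avg i dtzn + \<Delta>x *\<^sub>R (\<Sum>k=1..r. a j k *\<^sub>R avg i (dxdtz k))"
    if "j \<in> {1..r}" for i j
    unfolding avg_def a_def
    by (rule crk_avg_rk_step) (use aux_xt that int_dxdtz dtzn_integrable in auto)
  have avg_dtzn1: "avg i dtzn1 = avg i dtzn + \<Delta>x *\<^sub>R (\<Sum>j=1..r. bt j *\<^sub>R avg i (dxdtz j))" for i
    unfolding avg_def bt_def
    by (rule crk_avg_rk_step) (use aux_xt1 int_dxdtz dtzn_integrable in auto)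

  \<comment> \<open>Expansion of the CRK equations in antiderivatives of Lagrange
    polynomials\<close>
  have z_eq: "z j \<tau> = z j 0 + \<Delta>t *\<^sub>R (\<Sum>i=1..s. poly (L i) \<tau> *\<^sub>R avg i (dtz j))"
    if "\<tau> \<in> {0..1}" "j \<in> {1..r}" for \<tau> j
    using scheme_t[OF that] integral_crk_A[OF int(3)[OF that(2)]] by (simp add: L_def l_def avg_def)
  have dxz_eq: "dxz j \<tau> = dxz j 0 + \<Delta>t *\<^sub>R (\<Sum>i=1..s. poly (L i) \<tau> *\<^sub>R avg i (dtdxz j))"
    if "\<tau> \<in> {0..1}" "j \<in> {1..r}" for \<tau> j
    using aux_tx[OF that] integral_crk_A[OF dtdxz_integrable[OF that(2)]]
    by (simp add: L_def l_def avg_def)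
  have zn_eq: "zn \<tau> = zn 0 + \<Delta>t *\<^sub>R (\<Sum>i=1..s. poly (L i) \<tau> *\<^sub>R avg i dtzn)"
    if "\<tau> \<in> {0..1}" for \<tau>
    using aux_dtzn[OF that] integral_crk_A[OF dtzn_integrable] by (simp add: L_def l_def avg_def)

  text \<open>Differentiating the spatial stage equation in \<open>\<tau>\<close> and comparing coefficients of the \<open>l\<^sub>i\<close>
    shows that both mixed differences satisfy the same linear system, whose matrix is invertible.\<close>

  have avg_mixed: "avg i (dtdxz m) = avg i (dxdtz m)" if i: "i \<in> {1..s}" and m: "m \<in> {1..r}" for i m
  proof -
    have stage: "avg i (dtz j) = avg i dtzn + \<Delta>x *\<^sub>R (\<Sum>k=1..r. a j k *\<^sub>R avg i (dtdxz k))"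
      if j: "j \<in> {1..r}" for j
    proof -
      \<comment> \<open>The defect of the stage relation. Subtracting the spatial equation at 0 from
        that at \<tau> leaves a vanishing combination of the \<open>L i\<close> with coefficients
        \<open>v i\<close>.\<close>
      define v where "v i = avg i (dtz j) - avg i dtzn - \<Delta>x *\<^sub>R (\<Sum>k=1..r. a j k *\<^sub>R avg i (dtdxz k))" for i
      have "v i = 0"
      proof (rule antideriv_lagrange_independent[OF crk_nodes_distinct i])
        fix \<tau> :: real assume \<tau>: "\<tau> \<in> {0..1}"
        have z0: "z j 0 = zn 0 + \<Delta>x *\<^sub>R (\<Sum>k=1..r. a j k *\<^sub>R dxz k 0)"
          using scheme_x[of 0, OF _ j] by (simp add: a_def)
        have "(\<Sum>k=1..r. a j k *\<^sub>R dxz k \<tau>) = (\<Sum>k=1..r. a j k *\<^sub>R dxz k 0) +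
            (\<Sum>k=1..r. a j k *\<^sub>R \<Delta>t *\<^sub>R (\<Sum>i=1..s. poly (L i) \<tau> *\<^sub>R avg i (dtdxz k)))"
          unfolding sum.distrib[symmetric] scaleR_add_right[symmetric]
          by (intro sum.cong refl) (metis dxz_eq[OF \<tau>])
        also have "(\<Sum>k=1..r. a j k *\<^sub>R \<Delta>t *\<^sub>R (\<Sum>i=1..s. poly (L i) \<tau> *\<^sub>R avg i (dtdxz k))) =
            \<Delta>t *\<^sub>R (\<Sum>i=1..s. poly (L i) \<tau> *\<^sub>R (\<Sum>k=1..r. a j k *\<^sub>R avg i (dtdxz k)))"
          by (simp add: scaleR_sum_right ac_simps) (rule sum.swap)
        finally have "z j 0 + \<Delta>t *\<^sub>R (\<Sum>i=1..s. poly (L i) \<tau> *\<^sub>R avg i (dtz j)) =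
            zn 0 + \<Delta>t *\<^sub>R (\<Sum>i=1..s. poly (L i) \<tau> *\<^sub>R avg i dtzn) + \<Delta>x *\<^sub>R ((\<Sum>k=1..r. a j k *\<^sub>R dxz k 0) +
            \<Delta>t *\<^sub>R (\<Sum>i=1..s. poly (L i) \<tau> *\<^sub>R (\<Sum>k=1..r. a j k *\<^sub>R avg i (dtdxz k))))"
          using scheme_x[OF \<tau> j] z_eq[OF \<tau> j] zn_eq[OF \<tau>] by (simp add: a_def)
        then have "\<Delta>t *\<^sub>R (\<Sum>i=1..s. poly (L i) \<tau> *\<^sub>R v i) = 0"
          by (simp add: z0 v_def scaleR_diff_right sum_subtractf scaleR_add_right scaleR_sum_right
              scaleR_left_commute[of \<Delta>x] mult.left_commute)
        then show "(\<Sum>i=1..s. poly (antideriv_poly (lagrange_poly c s i)) \<tau> *\<^sub>R v i) = 0"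
          using dt_pos by (simp add: L_def l_def)
      qed
      then show ?thesis
        by (simp add: v_def algebra_simps)
    qed
    have "(\<Sum>k=1..r. a j k *\<^sub>R avg i (dtdxz k)) = (\<Sum>k=1..r. a j k *\<^sub>R avg i (dxdtz k))"
      if "j \<in> {1..r}" for j
      using stage[OF that] avg_dtz[OF that, of i] dx_pos by simp
    then show ?thesis
      using C_apply[OF m, of "\<lambda>k. avg i (dtdxz k)"] C_apply[OF m, of "\<lambda>k. avg i (dxdtz k)"] by simp
  qed

  \<comment> \<open>Energy increment at one spatial stage\<close>
  have energy: "discrete_energy S K (xn + ct j * \<Delta>x) (z j 1) (dxz j 1) -
      discrete_energy S K (xn + ct j * \<Delta>x) (z j 0) (dxz j 0) =
      \<Delta>t / 2 * (\<Sum>i=1..s. b i * (B (avg i (dtz j)) (avg i (dxz j)) - B (avg i (z j)) (avg i (dtdxz j))))"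
    if j: "j \<in> {1..r}" for j
  proof -
    define f where "f w = S w (xn + ct j * \<Delta>x)" for w
    define dz where "dz \<tau> = (\<Sum>i=1..s. poly (l i) \<tau> *\<^sub>R (\<Delta>t *\<^sub>R avg i (dtz j)))" for \<tau>
    define ddx where "ddx \<tau> = (\<Sum>i=1..s. poly (l i) \<tau> *\<^sub>R (\<Delta>t *\<^sub>R avg i (dtdxz j)))" for \<tau>
    \<comment> \<open>On [0,1] this is the gradient of \<open>f\<close> along \<open>z j\<close>, by
      the PDE stage equation; this form is linear in \<open>dtz\<close> and \<open>dxz\<close>, so
      its averages are computable.\<close>
    define g where "g \<tau> = M *v dtz j \<tau> + K *v dxz j \<tau>" for \<tau>
    have dz: "(z j has_vector_derivative dz \<tau>) (at \<tau> within {0..1})" if "\<tau> \<in> {0..1}" for \<tau>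
      unfolding dz_def l_def avg_def
      by (rule crk_has_vector_derivative[OF scheme_t[OF _ j] int(3)[OF j] that])
    have ddx: "(dxz j has_vector_derivative ddx \<tau>) (at \<tau> within {0..1})" if "\<tau> \<in> {0..1}" for \<tau>
      unfolding ddx_def l_def avg_def
      by (rule crk_has_vector_derivative[OF aux_tx[OF _ j] dtdxz_integrable[OF j] that])
    have mult_int: "(\<lambda>\<tau>. A *v h \<tau>) integrable_on {0..1}" if "h integrable_on {0..1}"
      for A :: "real^'d^'d" and h :: "real \<Rightarrow> real^'d"
      using integrable_linear[OF that matrix_vector_mul_bounded_linear, of A] by (simp add: o_def)
    have avg_mult: "avg i (\<lambda>\<tau>. A *v h \<tau>) = A *v avg i h" if "h integrable_on {0..1}"
      for A :: "real^'d^'d" and h :: "real \<Rightarrow> real^'d" and i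
      unfolding avg_def by (rule crk_avg_bounded_linear[OF matrix_vector_mul_bounded_linear that])
    have inner_int: "((\<lambda>\<tau>. h \<tau> \<bullet> (\<Sum>i=1..s. poly (l i) \<tau> *\<^sub>R (\<Delta>t *\<^sub>R v i))) has_integral
        \<Delta>t * (\<Sum>i=1..s. b i * (avg i h \<bullet> v i))) {0..1}"
      if "h integrable_on {0..1}" for h :: "real \<Rightarrow> real^'d" and v
      using has_integral_inner_lagrange_sum[OF that crk_weights_nonzero, of "\<lambda>i. \<Delta>t *\<^sub>R v i"]
      by (simp add: l_def b_def avg_def sum_distrib_left mult.left_commute)

    have f_int: "((\<lambda>\<tau>. g \<tau> \<bullet> dz \<tau>) has_integral f (z j 1) - f (z j 0)) {0..1}"
    proof (rule fundamental_theorem_of_calculus)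
      fix \<tau> :: real assume \<tau>: "\<tau> \<in> {0..1}"
      have "(f has_derivative (\<lambda>h. h \<bullet> g \<tau>)) (at (z j \<tau>))"
        using has_derivative_gradient[OF smooth_fun_differentiable[OF smooth_S]] scheme_pde[OF \<tau> j]
        by (simp add: f_def[abs_def] g_def)
      then show "((\<lambda>\<tau>. f (z j \<tau>)) has_vector_derivative g \<tau> \<bullet> dz \<tau>) (at \<tau> within {0..1})"
        using vector_derivative_diff_chain_within[OF dz[OF \<tau>] has_derivative_at_withinI]
        by (fastforce simp: o_def inner_commute)
    qed simp
    have g_int: "g integrable_on {0..1}"
      unfolding g_def by (intro integrable_add mult_int int j)
    have avg_g: "avg i g \<bullet> avg i (dtz j) = B (avg i (dtz j)) (avg i (dxz j))" for i
    proof -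
      have "avg i g = M *v avg i (dtz j) + K *v avg i (dxz j)"
        using crk_avg_add[OF mult_int[OF int(3)[OF j]] mult_int[OF int(4)[OF j]]]
          avg_mult[OF int(3)[OF j]] avg_mult[OF int(4)[OF j]]
        by (simp add: g_def[abs_def] avg_def)
      moreover have "(M *v avg i (dtz j)) \<bullet> avg i (dtz j) = 0"
        using skew_matrix_inner[OF skew_M, of "avg i (dtz j)" "avg i (dtz j)"]
        by (simp add: inner_commute)
      ultimately show ?thesis
        by (simp add: B_def inner_add_right inner_commute)
    qed
    have S_diff: "f (z j 1) - f (z j 0) = \<Delta>t * (\<Sum>i=1..s. b i * B (avg i (dtz j)) (avg i (dxz j)))"
      using f_int inner_int[OF g_int] unfolding dz_def avg_g[symmetric] by (rule has_integral_unique)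

    have B_int: "((\<lambda>\<tau>. B (z j \<tau>) (ddx \<tau>) + B (dz \<tau>) (dxz j \<tau>)) has_integral
        B (z j 1) (dxz j 1) - B (z j 0) (dxz j 0)) {0..1}"
      by (rule fundamental_theorem_of_calculus) (simp_all add: B.has_vector_derivative dz ddx)
    have B_right: "((\<lambda>\<tau>. B (z j \<tau>) (ddx \<tau>)) has_integral
        \<Delta>t * (\<Sum>i=1..s. b i * B (avg i (z j)) (avg i (dtdxz j)))) {0..1}"
      \<comment> \<open>Moving \<open>K\<close> onto \<open>z j\<close> brings the integrand to the
        shape of \<open>inner_int\<close> at the cost of a sign, which the negation
        restores.\<close>
      using has_integral_neg[OF inner_int[OF mult_int[OF int(2)[OF j], of K], of "\<lambda>i. avg i (dtdxz j)"]]
      by (simp add: ddx_def B_def avg_mult[OF int(2)[OF j]] skew_matrix_inner[OF skew_K] sum_negf)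
    have B_left: "((\<lambda>\<tau>. B (dz \<tau>) (dxz j \<tau>)) has_integral
        \<Delta>t * (\<Sum>i=1..s. b i * B (avg i (dtz j)) (avg i (dxz j)))) {0..1}"
      using inner_int[OF mult_int[OF int(4)[OF j], of K], of "\<lambda>i. avg i (dtz j)"]
      by (simp add: dz_def B_def avg_mult[OF int(4)[OF j]] inner_commute)
    have "B (z j 1) (dxz j 1) - B (z j 0) (dxz j 0) =
        \<Delta>t * (\<Sum>i=1..s. b i * B (avg i (z j)) (avg i (dtdxz j))) +
        \<Delta>t * (\<Sum>i=1..s. b i * B (avg i (dtz j)) (avg i (dxz j)))"
      by (rule has_integral_unique[OF B_int has_integral_add[OF B_right B_left]])
    \<comment> \<open>Half of the increment of \<open>B\<close> is subtracted: it halves the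
      contribution of \<open>S_diff\<close> and brings in the mixed term with a minus sign.\<close>
    with S_diff show ?thesis
      by (simp add: discrete_energy_def f_def flip: B_def)
        (simp add: right_diff_distrib sum_subtractf field_simps)
  qed

  \<comment> \<open>Flux increment and cancellation\<close>
  have flux: "B (avg i zn1) (avg i dtzn1) - B (avg i zn) (avg i dtzn) =
      \<Delta>x * (\<Sum>j=1..r. bt j * (B (avg i (dxz j)) (avg i (dtz j)) + B (avg i (z j)) (avg i (dxdtz j))))" for i
    using symplectic_rk_bilinear[where B = B and b = bt and a = a and r = r, OF B _ avg_z avg_dtz avg_zn1 avg_dtzn1]
      gauss_symplectic[OF gauss_nodes]
    by (simp add: a_def bt_def)
  have "discrete_flux c s K zn1 dtzn1 - discrete_flux c s K zn dtzn =
      1 / 2 * (\<Sum>i=1..s. b i * (B (avg i zn1) (avg i dtzn1) - B (avg i zn) (avg i dtzn)))"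
    by (simp add: discrete_flux_def B_def avg_def b_def right_diff_distrib sum_subtractf)
  \<comment> \<open>Skewness of \<open>B\<close> and equality of the averaged mixed differences turn
    the bracket of \<open>flux\<close> into minus the bracket of \<open>energy\<close>.\<close>
  also have "\<dots> = - (\<Delta>x / 2 * (\<Sum>i=1..s. \<Sum>j=1..r. bt j * (b i *
      (B (avg i (dtz j)) (avg i (dxz j)) - B (avg i (z j)) (avg i (dtdxz j))))))"
    unfolding flux sum_distrib_left sum_negf[symmetric]
    by (intro sum.cong refl) (simp add: avg_mixed B_skew[of "avg _ (dxz _)"] algebra_simps)
  also have "(\<Sum>i=1..s. \<Sum>j=1..r. bt j * (b i *
      (B (avg i (dtz j)) (avg i (dxz j)) - B (avg i (z j)) (avg i (dtdxz j))))) =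
      (\<Sum>j=1..r. bt j * (\<Sum>i=1..s. b i *
      (B (avg i (dtz j)) (avg i (dxz j)) - B (avg i (z j)) (avg i (dtdxz j)))))"
    unfolding sum_distrib_left by (rule sum.swap)
  finally show ?thesis
    by (simp add: energy sum_distrib_left flip: bt_def) (simp add: sum_distrib_left algebra_simps)
qed

end
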